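(* The following two closed-form evaluations of the generalized hypergeometric function ${}_4F_3$ at argument $\frac1{16}$ hold: $${}_4F_3\!\left(\begin{array}{c}\frac14,\ \frac14,\ \frac14,\ \frac34\\[1mm] \frac12,\ \frac54,\ \frac54\end{array}\Big|\,\frac1{16}\right)=\frac12\left[\pi^2\Big(\frac1{10}-\frac1{3\sqrt3}\Big)+\frac1{2\sqrt3}\,\psi'\Big(\frac13\Big)\right]$$ and $${}_4F_3\!\left(\begin{array}{c}\frac34,\ \frac34,\ \frac34,\ \frac54\\[1mm] \frac32,\ \frac74,\ \frac74\end{array}\Big|\,\frac1{16}\right)=36\left[\frac1{2\sqrt3}\,\psi'\Big(\frac13\Big)-\pi^2\Big(\frac1{10}+\frac1{3\sqrt3}\Big)\right],$$ where $\psi(z)=\Gamma'(z)/\Gamma(z)$ is the psi-function, i.e. the logarithmic derivative of the Euler gamma function $\Gamma(z)$, and $\psi'$ is its derivative.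
   Context: The generalized hypergeometric function is defined, for $|z|<1$, by the convergent series $${}_4F_3\!\left(\begin{array}{c}a_1,a_2,a_3,a_4\\ b_1,b_2,b_3\end{array}\Big|\,z\right)=\sum_{n\ge0}\frac{(a_1)_n(a_2)_n(a_3)_n(a_4)_n}{(b_1)_n(b_2)_n(b_3)_n}\,\frac{z^n}{n!},$$ where $(a)_n=\Gamma(a+n)/\Gamma(a)$ is the Pochhammer symbol: $(a)_0=1$ and $(a)_n=a(a+1)\cdots(a+n-1)$ for $n\ge1$. *)

theory Defs
  imports "HOL-Analysis.Analysis"
begin

text \<open>
  Meaningful for \<open>norm z < 1\<close> and lower parameters that are not non-positive integers.
\<close>

definition hypergeo_4F3 ::
  "'a \<Rightarrow> 'a \<Rightarrow> 'a \<Rightarrow> 'a \<Rightarrow> 'a \<Rightarrow> 'a \<Rightarrow> 'a \<Rightarrow> 'a \<Rightarrow> 'a :: {real_normed_field, banach}" where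
  "hypergeo_4F3 a1 a2 a3 a4 b1 b2 b3 z =
     (\<Sum>n. (pochhammer a1 n * pochhammer a2 n * pochhammer a3 n * pochhammer a4 n) /
          (pochhammer b1 n * pochhammer b2 n * pochhammer b3 n) * (z ^ n / fact n))"

text \<open>The series converges in the unit disc, so that \<^const>\<open>suminf\<close> is its actual sum.\<close>

lemma tendsto_shift_quotient:
  fixes a b :: "'a :: {real_normed_field, banach}"
  shows "(\<lambda>n. (a + of_nat n) / (b + of_nat n)) \<longlonglongrightarrow> 1"
proof -
  have "(\<lambda>n. (a * (1 / of_nat n) + 1) / (b * (1 / of_nat n) + 1)) \<longlonglongrightarrow> (a * 0 + 1) / (b * 0 + 1)"
    by (intro tendsto_intros lim_1_over_n) simp
  moreover have "eventually (\<lambda>n. (a * (1 / of_nat n) + 1) / (b * (1 / of_nat n) + 1) =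
                                 (a + of_nat n) / (b + of_nat n)) sequentially"
    using eventually_gt_at_top[of 0]
  proof eventually_elim
    case (elim n)
    have "(a * (1 / of_nat n) + 1) / (b * (1 / of_nat n) + 1) =
          ((a + of_nat n) / of_nat n) / ((b + of_nat n) / of_nat n)"
      using elim by (simp add: add_divide_distrib)
    also have "\<dots> = (a + of_nat n) / (b + of_nat n)"
      using elim by simp
    finally show ?case .
  qed
  ultimately show ?thesis
    by (simp add: tendsto_cong)
qed

lemma summable_hypergeo_4F3:
  fixes z :: "'a :: {real_normed_field, banach}"
  assumes "norm z < 1"
  shows "summable (\<lambda>n. (pochhammer a1 n * pochhammer a2 n * pochhammer a3 n * pochhammer a4 n) /
          (pochhammer b1 n * pochhammer b2 n * pochhammer b3 n) * (z ^ n / fact n))"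
    (is "summable ?f")
proof -
  define q where "q = (\<lambda>(a :: 'a) b n. (a + of_nat n) / (b + of_nat n))"
  define r where "r = (\<lambda>n. q a1 b1 n * q a2 b2 n * q a3 b3 n * q a4 1 n * z)"
  have "r \<longlonglongrightarrow> 1 * 1 * 1 * 1 * z"
    unfolding r_def q_def by (intro tendsto_intros tendsto_shift_quotient)
  hence lim: "(\<lambda>n. norm (r n)) \<longlonglongrightarrow> norm z"
    by (intro tendsto_norm) simp
  obtain c where c: "norm z < c" "c < 1"
    using assms dense by blast
  have "eventually (\<lambda>n. norm (r n) < c) sequentially"
    using order_tendstoD(2)[OF lim c(1)] .
  then obtain N where N: "\<And>n. n \<ge> N \<Longrightarrow> norm (r n) < c"
    unfolding eventually_sequentially by blast
  have step: "?f (Suc n) = r n * ?f n" for n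
    by (simp add: r_def q_def pochhammer_Suc divide_inverse mult_ac)
  show ?thesis
  proof (rule summable_ratio_test[OF c(2)])
    fix n assume "n \<ge> N"
    show "norm (?f (Suc n)) \<le> c * norm (?f n)"
      unfolding step norm_mult[of "r n"]
      by (intro mult_right_mono less_imp_le[OF N[OF \<open>n \<ge> N\<close>]] norm_ge_zero)
  qed
qed

text \<open>
  The library introduces \<^const>\<open>Polygamma\<close> (and hence \<open>Digamma\<close>) by series; away from the poles,
  \<open>Digamma\<close> is the logarithmic derivative of \<^const>\<open>Gamma\<close>, i.e. the psi-function.
\<close>

lemma Digamma_eq_deriv_Gamma:
  fixes z :: "'a :: Gamma"
  assumes "z \<notin> \<int>\<^sub>\<le>\<^sub>0"
  shows "Digamma z = deriv Gamma z / Gamma z"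
proof -
  have "deriv Gamma z = Gamma z * Digamma z"
    by (intro DERIV_imp_deriv has_field_derivative_Gamma assms)
  thus ?thesis
    using assms by (simp add: Gamma_eq_zero_iff)
qed

end

theory Submission
  imports Defs "HOL-Real_Asymp.Real_Asymp"
begin

text \<open>
  Let \<open>s m = ((2 * m) choose m) / (16 ^ m * (2 * m + 1)\<^sup>2)\<close>.  By the duplication formula for
  Pochhammer symbols, the coefficients of the first hypergeometric series are the \<open>s m\<close> with even
  \<open>m\<close>, and those of the second are \<open>72\<close> times the \<open>s m\<close> with odd \<open>m\<close> (\<open>hypergeo_term_even\<close>,
  \<open>hypergeo_term_odd\<close>).  So it suffices to evaluate \<open>\<Sum>m. s m\<close> and \<open>\<Sum>m. (-1) ^ m * s m\<close>.

  Up to simple factors, these are the values at \<open>- \<i> / 2\<close> and \<open>1 / 2\<close> of one analytic function, the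
  integral of \<open>arsinh t / t\<close> from \<open>0\<close> to \<open>z\<close>.  Substituting \<open>z = sinh u\<close> turns it into the integral
  of \<open>u * coth u\<close>, which is elementary up to a dilogarithm (\<open>arsinh_integral_sinh\<close>):
  \<open>u\<^sup>2 / 2 + u * Ln (1 - exp (- 2 * u)) + (pi\<^sup>2 / 6 - dilog (exp (- 2 * u))) / 2\<close>.

  For \<open>z = 1 / 2\<close>, \<open>u\<close> is the logarithm of the golden ratio, and the dilogarithm is known from its
  functional equations (\<open>dilog_golden\<close>); this gives \<open>\<Sum>m. (-1) ^ m * s m = pi\<^sup>2 / 10\<close>.  For
  \<open>z = - \<i> / 2\<close>, \<open>exp (- 2 * u)\<close> is a primitive sixth root of unity, and the sum of the \<open>s m\<close> is
  the imaginary part of its dilogarithm, the Clausen value \<open>\<Sum>n. sin (n * pi / 3) / n\<^sup>2\<close>.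
  Sorting this by residues modulo \<open>3\<close> expresses it by \<open>\<psi>' (1/3)\<close> and \<open>pi\<^sup>2\<close>
  (\<open>Im_dilog_cis_pi_third\<close>).
\<close>

section \<open>The dilogarithm\<close>

text \<open>
  The term at \<open>n = 0\<close> is \<open>1 / 0 = 0\<close>, so this is the usual series starting at \<open>n = 1\<close>.
  It converges on the closed unit disc; its values at the boundary points \<open>1\<close> and \<open>cis (pi / 3)\<close>
  are the source of \<open>pi\<^sup>2\<close> and \<open>\<psi>' (1/3)\<close>.
\<close>

definition dilog :: "complex \<Rightarrow> complex" where
  "dilog z = (\<Sum>n. z ^ n / of_nat n ^ 2)"

lemma basel_sums: "(\<lambda>n. 1 / real n ^ 2) sums (pi ^ 2 / 6)"
proof -
  have "(\<lambda>n. 1 / real (Suc n) ^ 2) sums (pi ^ 2 / 6)"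
    using inverse_squares_sums by (simp add: add.commute)
  thus ?thesis by (subst (asm) sums_Suc_iff) simp
qed

lemma summable_inverse_squares: "summable (\<lambda>n. 1 / real n ^ 2)"
  using basel_sums by (rule sums_summable)

lemma summable_dilog:
  fixes z :: complex
  assumes "norm z \<le> 1"
  shows "summable (\<lambda>n. z ^ n / of_nat n ^ 2)"
proof (rule summable_comparison_test'[OF summable_inverse_squares])
  show "norm (z ^ n / of_nat n ^ 2) \<le> 1 / real n ^ 2" for n
    using assms by (auto simp: norm_divide norm_power power_le_one intro!: divide_right_mono)
qed

lemma dilog_sums: "norm z \<le> 1 \<Longrightarrow> (\<lambda>n. z ^ n / of_nat n ^ 2) sums dilog z"
  unfolding dilog_def by (intro summable_sums summable_dilog)

lemma dilog_0 [simp]: "dilog 0 = 0"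
proof -
  have "(\<lambda>n. 0 ^ n / of_nat n ^ 2) = (\<lambda>n. 0 :: complex)"
  proof
    show "0 ^ n / of_nat n ^ 2 = (0 :: complex)" for n :: nat by (cases n) auto
  qed
  thus ?thesis unfolding dilog_def by simp
qed

lemma dilog_1: "dilog 1 = of_real (pi ^ 2 / 6)"
proof -
  have "(\<lambda>n. complex_of_real (1 / real n ^ 2)) sums of_real (pi ^ 2 / 6)"
    using basel_sums by (rule sums_of_real)
  moreover have "(\<lambda>n. complex_of_real (1 / real n ^ 2)) sums dilog 1"
    using dilog_sums[of 1] by simp
  ultimately show ?thesis by (rule sums_unique2[rotated])
qed

lemma cnj_dilog:
  assumes "norm z \<le> 1"
  shows "dilog (cnj z) = cnj (dilog z)"
proof -
  have "(\<lambda>n. cnj (z ^ n / of_nat n ^ 2)) sums cnj (dilog z)"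
    using dilog_sums[OF assms] by (subst sums_cnj)
  thus ?thesis by (simp add: dilog_def sums_iff)
qed

text \<open>
  Identities found by differentiation hold inside the disc only; continuity up to the boundary
  extends them to the unit circle and determines constants of integration from \<open>dilog 1\<close>.
\<close>

lemma continuous_on_dilog: "continuous_on (cball 0 1) dilog"
proof -
  have "uniform_limit (cball 0 1) (\<lambda>N z. \<Sum>n<N. z ^ n / of_nat n ^ 2) dilog sequentially"
    unfolding dilog_def
  proof (rule Weierstrass_m_test[OF _ summable_inverse_squares])
    show "norm (z ^ n / of_nat n ^ 2) \<le> 1 / real n ^ 2" if "z \<in> cball 0 1" for n and z :: complex
      using that by (auto simp: norm_divide norm_power power_le_one intro!: divide_right_mono)
  qed
  moreover have "\<forall>\<^sub>F N in sequentially.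
      continuous_on (cball 0 1) (\<lambda>z :: complex. \<Sum>n<N. z ^ n / of_nat n ^ 2)"
    unfolding divide_inverse by (intro always_eventually allI continuous_intros)
  ultimately show ?thesis
    by (intro uniform_limit_theorem) auto
qed

lemma tendsto_dilog:
  assumes "(f \<longlongrightarrow> z) F" "norm z \<le> 1" "\<forall>\<^sub>F x in F. norm (f x) \<le> 1"
  shows "((\<lambda>x. dilog (f x)) \<longlongrightarrow> dilog z) F"
  using continuous_on_tendsto_compose[OF continuous_on_dilog assms(1)] assms(2,3) by simp

lemma has_field_derivative_dilog:
  assumes "norm z < 1" "z \<noteq> 0"
  shows "(dilog has_field_derivative - Ln (1 - z) / z) (at z)"
proof -
  have "((\<lambda>z. \<Sum>n. (1 / of_nat n ^ 2) * z ^ n) has_field_derivative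
          (\<Sum>n. diffs (\<lambda>n. 1 / of_nat n ^ 2) n * z ^ n)) (at z)"
  proof (rule termdiffs_strong'[OF _ assms(1)])
    show "summable (\<lambda>n. (1 / of_nat n ^ 2) * w ^ n)" if "norm w < 1" for w :: complex
      using summable_dilog[of w] that by simp
  qed
  moreover have "(\<lambda>z. \<Sum>n. (1 / of_nat n ^ 2) * z ^ n) = dilog"
    by (auto simp: dilog_def fun_eq_iff)
  moreover have "(\<Sum>n. diffs (\<lambda>n. 1 / of_nat n ^ 2) n * z ^ n) = - Ln (1 - z) / z"
  proof -
    have "(\<lambda>n. - ((- (- z)) ^ n) / of_nat n) sums Ln (1 + - z)"
      using Ln_series'[of "- z"] assms by simp
    hence "(\<lambda>n. - (z ^ n / of_nat n)) sums Ln (1 - z)" by simp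
    hence "(\<lambda>n. z ^ n / of_nat n) sums - Ln (1 - z)"
      using sums_minus by fastforce
    hence "(\<lambda>n. z ^ Suc n / of_nat (Suc n)) sums - Ln (1 - z)"
      by (subst sums_Suc_iff) simp
    hence "(\<lambda>n. (z ^ Suc n / of_nat (Suc n)) / z) sums (- Ln (1 - z) / z)"
      by (rule sums_divide)
    also have "(\<lambda>n. (z ^ Suc n / of_nat (Suc n)) / z) =
               (\<lambda>n. diffs (\<lambda>n. 1 / of_nat n ^ 2) n * z ^ n)"
      using assms by (auto simp: diffs_def fun_eq_iff power2_eq_square simp del: of_nat_Suc)
    finally show ?thesis by (simp add: sums_iff)
  qed
  ultimately show ?thesis by simp
qed

lemmas has_field_derivative_dilog' [derivative_intros] = DERIV_chain2[OF has_field_derivative_dilog]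

lemma one_minus_notin_nonpos_Reals:
  assumes "norm (z :: complex) < 1"
  shows "1 - z \<notin> \<real>\<^sub>\<le>\<^sub>0"
  using assms abs_Re_le_cmod[of z] by (auto simp: complex_nonpos_Reals_iff)

text \<open>
  Adding the two series cancels the odd powers.  Only the series is used, so the identity also
  holds on the unit circle.
\<close>

lemma dilog_duplication:
  assumes "norm z \<le> 1"
  shows "dilog z + dilog (- z) = dilog (z ^ 2) / 2"
proof -
  have z2: "norm (z ^ 2) \<le> 1" using assms by (simp add: norm_power power_le_one)
  let ?f = "\<lambda>n. z ^ n / of_nat n ^ 2 + (- z) ^ n / of_nat n ^ 2"
  have "?f sums (dilog z + dilog (- z))"
    using assms by (intro sums_add dilog_sums) auto
  hence "(\<lambda>n. sum ?f {n * 2..<n * 2 + 2}) sums (dilog z + dilog (- z))"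
    by (rule sums_group) simp
  also have "(\<lambda>n. sum ?f {n * 2..<n * 2 + 2}) = (\<lambda>n. (z ^ 2) ^ n / of_nat n ^ 2 / 2)"
  proof
    fix n :: nat
    have "{n * 2..<n * 2 + 2} = {2 * n, Suc (2 * n)}" by auto
    hence "sum ?f {n * 2..<n * 2 + 2} = ?f (2 * n) + ?f (Suc (2 * n))" by simp
    also have "?f (Suc (2 * n)) = 0" by simp
    also have "?f (2 * n) = 2 * z ^ (2 * n) / (2 * of_nat n) ^ 2" by simp
    also have "\<dots> + 0 = (z ^ 2) ^ n / of_nat n ^ 2 / 2"
      unfolding power_mult power_mult_distrib by simp
    finally show "sum ?f {n * 2..<n * 2 + 2} = (z ^ 2) ^ n / of_nat n ^ 2 / 2" .
  qed
  finally have "(\<lambda>n. (z ^ 2) ^ n / of_nat n ^ 2 / 2) sums (dilog z + dilog (- z))" .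
  moreover have "(\<lambda>n. (z ^ 2) ^ n / of_nat n ^ 2 / 2) sums (dilog (z ^ 2) / 2)"
    using dilog_sums[OF z2] by (rule sums_divide)
  ultimately show ?thesis by (rule sums_unique2)
qed

text \<open>
  The derivatives of \<open>dilog z + dilog (1 - z)\<close> and \<open>- Ln z * Ln (1 - z)\<close> agree on the
  intersection of the discs around \<open>0\<close> and \<open>1\<close>, which is convex.  The constant is found by letting
  \<open>z\<close> tend to \<open>0\<close> along the positive reals, where \<open>ln x * ln (1 - x)\<close> tends to \<open>0\<close>.
\<close>

lemma dilog_reflection:
  assumes "norm z < 1" "norm (1 - z) < 1"
  shows "dilog z + dilog (1 - z) = of_real (pi ^ 2 / 6) - Ln z * Ln (1 - z)"
proof -
  define S where "S = ball 0 1 \<inter> ball (1 :: complex) 1"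
  define f where "f = (\<lambda>z. dilog z + dilog (1 - z) + Ln z * Ln (1 - z))"
  have "(f has_field_derivative 0) (at w within S)" if "w \<in> S" for w
  proof -
    have w: "norm w < 1" "norm (1 - w) < 1"
      using that by (auto simp: S_def dist_norm norm_minus_commute)
    have w': "w \<noteq> 0" "w \<noteq> 1" using w by auto
    have w'': "w \<notin> \<real>\<^sub>\<le>\<^sub>0" "1 - w \<notin> \<real>\<^sub>\<le>\<^sub>0"
      using one_minus_notin_nonpos_Reals[of w] one_minus_notin_nonpos_Reals[of "1 - w"] w by simp_all
    have d1: "(dilog has_field_derivative - Ln (1 - w) / w) (at w)"
      using w w' by (intro has_field_derivative_dilog)
    have d2: "((\<lambda>z. dilog (1 - z)) has_field_derivative (- Ln (1 - (1 - w)) / (1 - w)) * (0 - 1)) (at w)"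
      using w w' by (intro has_field_derivative_dilog' derivative_intros) auto
    have d3: "(Ln has_field_derivative 1 / w) (at w)"
      using w' w'' by (auto intro!: derivative_eq_intros simp: inverse_eq_divide)
    have d4: "((\<lambda>z. Ln (1 - z)) has_field_derivative - 1 / (1 - w)) (at w)"
      using w' w'' by (auto intro!: derivative_eq_intros simp: inverse_eq_divide)
    have "(f has_field_derivative
        (- Ln (1 - w) / w + (- Ln (1 - (1 - w)) / (1 - w)) * (0 - 1)
          + (Ln w * (- 1 / (1 - w)) + 1 / w * Ln (1 - w)))) (at w)"
      unfolding f_def by (intro DERIV_add DERIV_mult' d1 d2 d3 d4)
    hence "(f has_field_derivative 0) (at w)" by simp
    thus ?thesis by (rule has_field_derivative_at_within)
  qed
  then obtain c where c: "\<And>w. w \<in> S \<Longrightarrow> f w = c"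
    using has_field_derivative_zero_constant[of S f] by (force simp: S_def convex_Int)
  have e: "1 - complex_of_real x = of_real (1 - x)" for x by simp
  have ev: "\<forall>\<^sub>F x in at_right (0 :: real). x \<in> {0<..<1}"
    by (intro eventually_at_right_real) auto
  have "((\<lambda>x :: real. dilog (of_real x) + dilog (1 - of_real x) + of_real (ln x * ln (1 - x))) 
          \<longlongrightarrow> dilog 0 + dilog 1 + of_real 0) (at_right 0)"
  proof (intro tendsto_add tendsto_dilog tendsto_of_real)
    show "((\<lambda>x :: real. complex_of_real x) \<longlongrightarrow> 0) (at_right 0)"
      by (auto intro!: tendsto_eq_intros)
    show "((\<lambda>x :: real. 1 - complex_of_real x) \<longlongrightarrow> 1) (at_right 0)"
      by (auto intro!: tendsto_eq_intros)
    show "((\<lambda>x :: real. ln x * ln (1 - x)) \<longlongrightarrow> 0) (at_right 0)"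
      by real_asymp
    show "\<forall>\<^sub>F x in at_right (0 :: real). norm (complex_of_real x) \<le> 1"
      using ev by eventually_elim auto
    show "\<forall>\<^sub>F x in at_right (0 :: real). norm (1 - complex_of_real x) \<le> 1"
      using ev unfolding e by eventually_elim (auto simp del: of_real_diff)
  qed auto
  moreover have "\<forall>\<^sub>F x in at_right (0 :: real).
      dilog (of_real x) + dilog (1 - of_real x) + of_real (ln x * ln (1 - x)) = c"
    using ev
  proof eventually_elim
    case (elim x)
    have "complex_of_real x \<in> S"
      using elim by (auto simp: S_def dist_norm e simp del: of_real_diff)
    from c[OF this] show ?case
      using elim by (simp add: f_def e Ln_of_real del: of_real_diff)
  qed
  ultimately have "((\<lambda>x :: real. c) \<longlongrightarrow> dilog 0 + dilog 1 + of_real 0) (at_right 0)"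
    by (rule Lim_transform_eventually)
  hence "c = of_real (pi ^ 2 / 6)"
    by (simp add: tendsto_const_iff dilog_1)
  with c[of z] assms show ?thesis
    by (simp add: f_def S_def dist_norm norm_minus_commute algebra_simps)
qed

text \<open>
  Again both sides have the same derivative.  The radius \<open>1 / 2\<close> ensures that \<open>z / (z - 1)\<close>
  stays in the unit disc.
\<close>

lemma dilog_Landen:
  assumes "norm z < 1 / 2"
  shows "dilog z + dilog (z / (z - 1)) = - (Ln (1 - z) ^ 2) / 2"
proof -
  define f where "f = (\<lambda>z. dilog z + dilog (z / (z - 1)) + Ln (1 - z) ^ 2 / 2)"
  have 1: "norm w < 1" "norm (w / (w - 1)) < 1" "w \<noteq> 1" if "norm w < 1 / 2" for w :: complex
  proof -
    show "norm w < 1" "w \<noteq> 1" using that by auto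
    have "norm (w - 1) \<ge> 1 - norm w"
      using norm_triangle_ineq2[of 1 w] by (simp add: norm_minus_commute)
    with that have "norm w < norm (w - 1)" by linarith
    thus "norm (w / (w - 1)) < 1"
      by (metis divide_less_eq_1 norm_divide norm_ge_zero order_le_less_trans)
  qed
  have deriv: "(f has_field_derivative 0) (at w)" if w: "norm w < 1 / 2" "w \<noteq> 0" for w
  proof -
    have "1 - w / (w - 1) = 1 / (1 - w)"
      using 1[OF w(1)] by (simp add: divide_simps)
    hence L: "Ln (1 - w / (w - 1)) = - Ln (1 - w)"
      using one_minus_notin_nonpos_Reals[OF 1(1)[OF w(1)]] 1(3)[OF w(1)]
      by (simp add: Ln_inverse flip: inverse_eq_divide)
    have nz: "1 - w \<noteq> 0" "w - 1 \<noteq> 0" using 1(3)[OF w(1)] by auto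
    have quot: "((\<lambda>z. z / (z - 1)) has_field_derivative - 1 / (w - 1) ^ 2) (at w)"
      using nz by (auto intro!: derivative_eq_intros simp: power2_eq_square)
    have log: "((\<lambda>z. Ln (1 - z) ^ 2 / 2) has_field_derivative - Ln (1 - w) / (1 - w)) (at w)"
      using nz one_minus_notin_nonpos_Reals[OF 1(1)[OF w(1)]]
      by (auto intro!: derivative_eq_intros simp: inverse_eq_divide) (simp add: divide_simps)
    have "(f has_field_derivative
            (- Ln (1 - w) / w + (- Ln (1 - w / (w - 1)) / (w / (w - 1))) * (- 1 / (w - 1) ^ 2) +
               - Ln (1 - w) / (1 - w))) (at w)"
      unfolding f_def using 1[OF w(1)] w(2)
      by (intro DERIV_add log has_field_derivative_dilog has_field_derivative_dilog'[OF _ _ quot]) auto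
    also have "- Ln (1 - w) / w + (- Ln (1 - w / (w - 1)) / (w / (w - 1))) * (- 1 / (w - 1) ^ 2) +
               - Ln (1 - w) / (1 - w) = 0"
      unfolding L using nz w(2) by (simp add: divide_simps power2_eq_square) (simp add: algebra_simps)?
    finally show ?thesis .
  qed
  \<comment> \<open>The derivative formula for the dilogarithm has \<open>z\<close> in the denominator, so \<open>0\<close> is treated
      as an exceptional point, at which continuity suffices.\<close>
  have "f constant_on ball 0 (1 / 2)"
  proof (rule DERIV_zero_connected_constant_on[where K = "{0}"])
    show "continuous_on (ball 0 (1 / 2)) f"
      unfolding f_def using 1 one_minus_notin_nonpos_Reals
      by (intro continuous_intros continuous_on_compose2[OF continuous_on_dilog])
         (auto simp: less_imp_le)
  qed (use deriv in auto)
  then obtain c where c: "\<And>w. norm w < 1 / 2 \<Longrightarrow> f w = c" by (auto simp: constant_on_def)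
  have "f z = f 0"
    using c[of z] c[of 0] assms by simp
  thus ?thesis by (simp add: f_def algebra_simps eq_neg_iff_add_eq_0)
qed

section \<open>The series of the arsinh integral\<close>

text \<open>
  Integrating \<open>\<Sum>n. c n * z ^ (2 * n)\<close> term by term.  It is applied twice: to the binomial series of
  \<open>(1 + z\<^sup>2) powr (- 1/2)\<close>, which yields arsinh, and to the series of \<open>arsinh z / z\<close>.  In both cases
  the coefficients are bounded by \<open>1\<close>, so the unit disc is a domain of convergence.
\<close>

lemma odd_power_series_deriv:
  fixes c :: "nat \<Rightarrow> complex" and z :: complex
  assumes c: "\<And>n. norm (c n) \<le> 1" and z: "norm z < 1"
  shows "summable (\<lambda>n. c n * z ^ (2 * n))"
    and "((\<lambda>z. \<Sum>n. c n / of_nat (2 * n + 1) * z ^ (2 * n + 1)) has_field_derivative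
           (\<Sum>n. c n * z ^ (2 * n))) (at z)"
proof -
  have summ: "summable (\<lambda>n. d n * w ^ n)" if "\<And>n. norm (d n) \<le> 1" "norm w < 1" for d and w :: complex
  proof (rule summable_comparison_test'[of "\<lambda>n. norm w ^ n"])
    show "summable (\<lambda>n. norm w ^ n)" using that by (intro summable_geometric) auto
    show "norm (d n * w ^ n) \<le> norm w ^ n" for n
      using that(1)[of n] by (simp add: norm_mult norm_power mult_left_le_one_le)
  qed
  have sq: "norm (w ^ 2) < 1" if "norm w < 1" for w :: complex
    using that by (simp add: norm_power power_less_one_iff)
  show 1: "summable (\<lambda>n. c n * z ^ (2 * n))"
    using summ[OF c sq[OF z]] by (simp add: power_mult)

  define d where "d = (\<lambda>n. c n / of_nat (2 * n + 1))"
  define f where "f = (\<lambda>w. \<Sum>n. d n * w ^ n)"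
  have d: "norm (d n) \<le> 1" for n
  proof -
    have "norm (d n) = norm (c n) / real (2 * n + 1)"
      unfolding d_def norm_divide by (simp only: norm_of_nat)
    also have "\<dots> \<le> 1 / 1" using c by (intro frac_le) auto
    finally show ?thesis by simp
  qed
  define w where "w = z ^ 2"
  have w: "norm w < 1" using sq[OF z] by (simp add: w_def)
  have "(f has_field_derivative (\<Sum>n. diffs d n * w ^ n)) (at w)"
    unfolding f_def using w summ[OF d] by (intro termdiffs_strong'[where K = 1]) auto
  hence "(f has_field_derivative (\<Sum>n. diffs d n * w ^ n)) (at (z ^ 2))" by (simp add: w_def)
  hence "((\<lambda>z. f (z ^ 2)) has_field_derivative (\<Sum>n. diffs d n * w ^ n) * (2 * z)) (at z)"
    by (rule DERIV_chain2) (auto intro!: derivative_eq_intros)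
  from DERIV_mult'[OF DERIV_ident this]
  have "((\<lambda>z. z * f (z ^ 2)) has_field_derivative
          (2 * w * (\<Sum>n. diffs d n * w ^ n) + f w)) (at z)"
    by (simp add: w_def power2_eq_square mult_ac)
  also have "2 * w * (\<Sum>n. diffs d n * w ^ n) + f w = (\<Sum>n. c n * z ^ (2 * n))"
  proof -
    have "(\<lambda>n. diffs d n * w ^ n) sums (\<Sum>n. diffs d n * w ^ n)"
      using termdiff_converges[OF w summ[OF d]] by (simp add: summable_sums)
    hence "(\<lambda>n. 2 * w * (diffs d n * w ^ n)) sums (2 * w * (\<Sum>n. diffs d n * w ^ n))"
      by (rule sums_mult)
    also have "(\<lambda>n. 2 * w * (diffs d n * w ^ n)) =
               (\<lambda>n. of_nat (2 * Suc n) * d (Suc n) * w ^ Suc n)"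
      by (auto simp: diffs_def fun_eq_iff algebra_simps)
    finally have "(\<lambda>n. of_nat (2 * n) * d n * w ^ n) sums (2 * w * (\<Sum>n. diffs d n * w ^ n))"
      by (subst (asm) sums_Suc_iff) simp
    moreover have "(\<lambda>n. d n * w ^ n) sums f w"
      unfolding f_def using summ[OF d w] by (rule summable_sums)
    ultimately have "(\<lambda>n. of_nat (2 * n) * d n * w ^ n + d n * w ^ n) sums
                       (2 * w * (\<Sum>n. diffs d n * w ^ n) + f w)"
      by (rule sums_add)
    also have "(\<lambda>n. of_nat (2 * n) * d n * w ^ n + d n * w ^ n) = (\<lambda>n. c n * z ^ (2 * n))"
    proof
      fix n
      have "of_nat (2 * n + 1) * d n = c n"
        unfolding d_def by (metis Suc_eq_plus1 nonzero_mult_div_cancel_left of_nat_neq_0 times_divide_eq_right)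
      moreover have "of_nat (2 * n) * d n * w ^ n + d n * w ^ n = of_nat (2 * n + 1) * d n * w ^ n"
        by (simp add: algebra_simps)
      ultimately show "of_nat (2 * n) * d n * w ^ n + d n * w ^ n = c n * z ^ (2 * n)"
        by (simp only: w_def power_mult)
    qed
    finally show ?thesis by (simp add: sums_iff)
  qed
  finally show "((\<lambda>z. \<Sum>n. c n / of_nat (2 * n + 1) * z ^ (2 * n + 1)) has_field_derivative
                  (\<Sum>n. c n * z ^ (2 * n))) (at z)"
  proof (rule has_field_derivative_transform_within_open[where S = "ball 0 1"])
    fix y :: complex assume "y \<in> ball 0 1"
    hence "summable (\<lambda>n. d n * (y ^ 2) ^ n)" using summ[OF d sq[of y]] by simp
    from suminf_mult[OF this, of y]
    have "y * f (y ^ 2) = (\<Sum>n. y * (d n * (y ^ 2) ^ n))" by (simp add: f_def)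
    also have "(\<lambda>n. y * (d n * (y ^ 2) ^ n)) = (\<lambda>n. d n * y ^ (2 * n + 1))"
      by (simp only: power_add power_mult power_one_right) (simp only: mult_ac)
    finally show "y * f (y ^ 2) = (\<Sum>n. c n / of_nat (2 * n + 1) * y ^ (2 * n + 1))"
      by (simp only: d_def)
  qed (use z in auto)
qed

text \<open>
  This is the integral of \<open>arsinh t / t\<close> from \<open>0\<close> to \<open>z\<close>; one factor \<open>2 * n + 1\<close> comes from
  integrating the binomial series to arsinh, the other from the second integration.
\<close>

definition arsinh_integral :: "complex \<Rightarrow> complex" where
  "arsinh_integral z =
     (\<Sum>n. ((- 1 / 2) gchoose n) / of_nat (2 * n + 1) ^ 2 * z ^ (2 * n + 1))"

lemma pochhammer_half_nonneg: "pochhammer (1 / 2 :: real) n \<ge> 0"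
  by (intro less_imp_le pochhammer_pos) simp

lemma pochhammer_half_le_fact: "pochhammer (1 / 2 :: real) n \<le> fact n"
proof (induction n)
  case (Suc n)
  have "(1 / 2 + real n) * pochhammer (1 / 2) n \<le> (1 + real n) * fact n"
    using Suc.IH pochhammer_half_nonneg by (intro mult_mono) auto
  thus ?case by (simp add: pochhammer_rec')
qed auto

lemma gbinomial_minus_half:
  "((- 1 / 2 :: complex) gchoose n) = of_real ((- 1) ^ n * (pochhammer (1 / 2) n / fact n))"
  by (simp add: gbinomial_pochhammer flip: pochhammer_of_real)

lemma norm_gbinomial_minus_half: "norm ((- 1 / 2 :: complex) gchoose n) \<le> 1"
  using pochhammer_half_nonneg[of n] pochhammer_half_le_fact[of n]
  unfolding gbinomial_minus_half norm_of_real by (simp add: abs_mult power_abs)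

text \<open>
  The series of \<open>sinh\<close> has nonnegative coefficients, so \<open>norm (sinh u) \<le> sinh (norm u)\<close>, and
  \<open>sinh x < exp x / 2\<close>.  The radius \<open>ln 2\<close> is large enough to contain both arguments
  used below, the logarithm of the golden ratio and \<open>- \<i> * pi / 6\<close>.
\<close>

lemma norm_sinh_less_1:
  assumes "norm (u :: complex) < ln 2"
  shows "norm (sinh u) < 1"
proof -
  have "norm (sinh u) \<le> sinh (norm u)"
  proof -
    have *: "(\<lambda>n. norm (if even n then 0 else u ^ n /\<^sub>R fact n)) = (\<lambda>n. if even n then 0 else norm u ^ n /\<^sub>R fact n)"
      by (auto simp: norm_power norm_inverse fun_eq_iff)
    show ?thesis
      using norm_suminf_le[of "\<lambda>n. if even n then 0 else u ^ n /\<^sub>R fact n", OF _ sums_summable[OF sinh_converges[of "norm u"]]]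
        sinh_converges[of u] sinh_converges[of "norm u"] fun_cong[OF *] by (simp add: sums_iff)
  qed
  also have "sinh (norm u) < exp (norm u) / 2" by (simp add: sinh_def)
  also have "exp (norm u) < exp (ln 2)" using assms unfolding exp_less_cancel_iff .
  finally show ?thesis by simp
qed

lemma Re_cosh_pos:
  assumes "\<bar>Im u\<bar> < pi / 2"
  shows "Re (cosh u) > 0"
  using assms by (auto simp: cosh_conv_cos Re_cos cos_gt_zero_pi intro!: mult_pos_pos add_pos_pos)

text \<open>
  The left-hand side has derivative \<open>(1 + (sinh u)\<^sup>2) powr (- 1/2) * cosh u = 1\<close>; for this the
  principal square root of \<open>(cosh u)\<^sup>2\<close> has to be \<open>cosh u\<close>, that is, \<open>Re (cosh u) > 0\<close>.
\<close>

lemma arsinh_series: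
  fixes u :: complex
  assumes "norm u < ln 2"
  shows "(\<Sum>n. ((- 1 / 2) gchoose n) / of_nat (2 * n + 1) * sinh u ^ (2 * n + 1)) = u"
proof -
  define A :: "complex \<Rightarrow> complex"
    where "A = (\<lambda>z. \<Sum>n. ((- 1 / 2) gchoose n) / of_nat (2 * n + 1) * z ^ (2 * n + 1))"
  have "((\<lambda>u. A (sinh u) - u) has_field_derivative 0) (at v within ball 0 (ln 2))"
    if "v \<in> ball 0 (ln 2)" for v
  proof -
    have sinh: "norm (sinh v) < 1" using that by (intro norm_sinh_less_1) auto
    have "ln 2 < pi / 2" using ln_2_less_1 pi_gt3 by linarith
    with that have "\<bar>Im v\<bar> < pi / 2" using abs_Im_le_cmod[of v] by auto
    hence cosh: "Re (cosh v) > 0" by (rule Re_cosh_pos)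
    hence "cosh v \<noteq> 0" by auto
    have "(\<lambda>n. ((- 1 / 2) gchoose n) * (sinh v ^ 2) ^ n) sums (1 + sinh v ^ 2) powr (- 1 / 2)"
      using sinh by (intro gen_binomial_complex) (simp add: norm_power power_less_one_iff)
    moreover have "(1 + sinh v ^ 2) powr (- 1 / 2) = inverse (csqrt (cosh v ^ 2))"
      using powr_minus[of "cosh v ^ 2" "1 / 2"] by (simp add: cosh_square_eq add_ac csqrt_conv_powr)
    ultimately have "(\<Sum>n. ((- 1 / 2) gchoose n) * sinh v ^ (2 * n)) = inverse (cosh v)"
      using cosh by (simp add: sums_iff power_mult csqrt_square)
    hence "(A has_field_derivative inverse (cosh v)) (at (sinh v))"
      using odd_power_series_deriv(2)[where c = "\<lambda>n. (- 1 / 2) gchoose n", OF norm_gbinomial_minus_half sinh]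
      unfolding A_def by argo
    from DERIV_chain2[OF this has_field_derivative_sinh[OF DERIV_ident]]
    have "((\<lambda>u. A (sinh u)) has_field_derivative 1) (at v within ball 0 (ln 2))"
      using \<open>cosh v \<noteq> 0\<close> by simp
    from DERIV_diff[OF this DERIV_ident] show ?thesis by simp
  qed
  then obtain c where "\<And>v. v \<in> ball 0 (ln 2) \<Longrightarrow> A (sinh v) - v = c"
    using has_field_derivative_zero_constant[of "ball 0 (ln 2)" "\<lambda>u. A (sinh u) - u"] by auto
  from this[of u] this[of 0] assms show ?thesis by (simp add: A_def)
qed

lemma has_field_derivative_arsinh_integral:
  assumes "norm z < 1"
  shows "(arsinh_integral has_field_derivative
           (\<Sum>n. ((- 1 / 2) gchoose n) / of_nat (2 * n + 1) * z ^ (2 * n))) (at z)"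
    and "summable (\<lambda>n. ((- 1 / 2) gchoose n) / of_nat (2 * n + 1) * z ^ (2 * n))"
proof -
  define c :: "nat \<Rightarrow> complex" where "c = (\<lambda>n. ((- 1 / 2) gchoose n) / of_nat (2 * n + 1))"
  have c: "norm (c n) \<le> 1" for n
  proof -
    have "norm (c n) = norm ((- 1 / 2 :: complex) gchoose n) / real (2 * n + 1)"
      unfolding c_def norm_divide by (simp only: norm_of_nat)
    also have "\<dots> \<le> 1 / 1" using norm_gbinomial_minus_half by (intro frac_le) auto
    finally show ?thesis by simp
  qed
  have "arsinh_integral = (\<lambda>z. \<Sum>n. c n / of_nat (2 * n + 1) * z ^ (2 * n + 1))"
    unfolding arsinh_integral_def c_def by (simp add: power2_eq_square)
  thus "(arsinh_integral has_field_derivative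
          (\<Sum>n. ((- 1 / 2) gchoose n) / of_nat (2 * n + 1) * z ^ (2 * n))) (at z)"
    using odd_power_series_deriv(2)[where c = c, OF c assms] by (simp only: c_def)
  show "summable (\<lambda>n. ((- 1 / 2) gchoose n) / of_nat (2 * n + 1) * z ^ (2 * n))"
    using odd_power_series_deriv(1)[where c = c, OF c assms] by (simp only: c_def)
qed

lemma has_field_derivative_arsinh_integral_at_sinh:
  assumes "norm u < ln 2" "sinh u \<noteq> 0"
  shows "(arsinh_integral has_field_derivative u / sinh u) (at (sinh u))"
proof -
  have sinh: "norm (sinh u) < 1" using assms by (intro norm_sinh_less_1)
  let ?c = "\<lambda>n. ((- 1 / 2) gchoose n) / of_nat (2 * n + 1) :: complex"
  have "sinh u * (\<Sum>n. ?c n * sinh u ^ (2 * n)) = (\<Sum>n. sinh u * (?c n * sinh u ^ (2 * n)))"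
    using has_field_derivative_arsinh_integral(2)[OF sinh] by (rule suminf_mult[symmetric])
  also have "\<dots> = u"
    using arsinh_series[OF assms(1)] by (simp add: mult_ac)
  finally have "(\<Sum>n. ?c n * sinh u ^ (2 * n)) * sinh u = u" by (simp only: mult.commute)
  hence "(\<Sum>n. ?c n * sinh u ^ (2 * n)) = u / sinh u"
    using nonzero_eq_divide_eq[OF assms(2)] by blast
  thus ?thesis
    using has_field_derivative_arsinh_integral(1)[OF sinh] by (simp only:)
qed

section \<open>The arsinh integral in terms of the dilogarithm\<close>

lemma Re_pos_of_norm_le_1:
  fixes w :: complex
  assumes "norm w \<le> 1" "w \<noteq> 1"
  shows "Re (1 - w) > 0"
proof (rule ccontr)
  assume "\<not> ?thesis"
  hence "Re w \<ge> 1" by simp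
  moreover from this have "Re w = norm w" using assms(1) complex_Re_le_cmod[of w] by linarith
  ultimately have "Re w = 1" "norm w = 1" using assms(1) by linarith+
  hence "Im w = 0" using cmod_power2[of w] by simp
  with \<open>Re w = 1\<close> assms(2) show False by (simp add: complex_eq_iff)
qed

lemma sinh_neq_0_if_Re_pos:
  fixes u :: complex
  assumes "Re u > 0"
  shows "sinh u \<noteq> 0"
proof -
  have "norm (exp (- u)) < norm (exp u)" using assms by simp
  hence "exp u \<noteq> exp (- u)" by (metis less_irrefl)
  thus ?thesis by (simp add: sinh_def)
qed

lemma arsinh_integral_0 [simp]: "arsinh_integral 0 = 0"
  by (simp add: arsinh_integral_def)

lemma isCont_arsinh_integral: "norm z < 1 \<Longrightarrow> isCont arsinh_integral z"
  by (rule DERIV_isCont[OF has_field_derivative_arsinh_integral(1)])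

text \<open>
  Under \<open>z = sinh u\<close> the integrand becomes \<open>u * coth u\<close>, and
  \<open>coth u = 1 + 2 * w / (1 - w)\<close> with \<open>w = exp (- 2 * u)\<close> leads to an explicit antiderivative.
  The open half-disc \<open>Re u > 0\<close> is where \<open>w\<close> lies inside the unit disc; the constant of integration
  comes from \<open>u\<close> tending to \<open>0\<close> along the positive reals, where \<open>dilog w\<close> tends to
  \<open>dilog 1 = pi\<^sup>2 / 6\<close>.
\<close>

lemma arsinh_integral_sinh_interior:
  assumes "norm u < ln 2" "Re u > 0"
  shows "arsinh_integral (sinh u) =
           u ^ 2 / 2 + u * Ln (1 - exp (- 2 * u)) + (of_real (pi ^ 2 / 6) - dilog (exp (- 2 * u))) / 2"
proof -
  define R where "R = (\<lambda>u. u ^ 2 / 2 + u * Ln (1 - exp (- 2 * u)) +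
                       (of_real (pi ^ 2 / 6) - dilog (exp (- 2 * u))) / 2)"
  define S where "S = ball 0 (ln 2) \<inter> {u. Re u > 0}"
  have "((\<lambda>u. arsinh_integral (sinh u) - R u) has_field_derivative 0) (at v within S)" if "v \<in> S" for v
  proof -
    have v: "norm v < ln 2" "Re v > 0" using that by (auto simp: S_def)
    define w where "w = exp (- 2 * v)"
    have w: "norm w < 1" "w \<noteq> 0" using v by (auto simp: w_def)
    hence w1: "1 - w \<noteq> 0" by auto
    have sinh: "sinh v \<noteq> 0" using v by (intro sinh_neq_0_if_Re_pos)
    have cosh_w: "cosh v / sinh v = (1 + w) / (1 - w)"
    proof -
      have "exp v * w = exp (- v)" unfolding w_def by (simp flip: exp_add)
      hence "exp v * (1 + w) = exp v + exp (- v)" "exp v * (1 - w) = exp v - exp (- v)"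
        by (simp_all add: ring_distribs)
      hence "2 * cosh v = exp v * (1 + w)" "2 * sinh v = exp v * (1 - w)"
        by (simp_all add: cosh_field_def sinh_field_def)
      hence "(2 * cosh v) / (2 * sinh v) = (1 + w) / (1 - w)" by simp
      thus ?thesis by simp
    qed
    have L: "((\<lambda>u. arsinh_integral (sinh u)) has_field_derivative v / sinh v * cosh v) (at v)"
      using DERIV_chain2[OF has_field_derivative_arsinh_integral_at_sinh[OF v(1) sinh]
              has_field_derivative_sinh[OF DERIV_ident]] by simp
    have W: "((\<lambda>u. exp (- 2 * u)) has_field_derivative - 2 * w) (at v)"
      by (auto intro!: derivative_eq_intros simp: w_def)
    have Lg: "((\<lambda>u. Ln (1 - exp (- 2 * u))) has_field_derivative 2 * w / (1 - w)) (at v)"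
      using one_minus_notin_nonpos_Reals[OF w(1)]
      by (auto intro!: derivative_eq_intros simp: w_def inverse_eq_divide)
    have D: "((\<lambda>u. dilog (exp (- 2 * u))) has_field_derivative (- Ln (1 - w) / w) * (- 2 * w)) (at v)"
      unfolding w_def by (rule has_field_derivative_dilog') (use w W in \<open>auto simp: w_def\<close>)
    have "(R has_field_derivative
            (2 * v / 2 + (v * (2 * w / (1 - w)) + 1 * Ln (1 - w)) +
              (0 - (- Ln (1 - w) / w) * (- 2 * w)) / 2)) (at v)"
      unfolding R_def
      by (intro DERIV_add DERIV_cdivide DERIV_diff DERIV_const D DERIV_mult'[OF DERIV_ident Lg, folded w_def])
         (auto intro!: derivative_eq_intros)
    also have "(2 * v / 2 + (v * (2 * w / (1 - w)) + 1 * Ln (1 - w)) +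
              (0 - (- Ln (1 - w) / w) * (- 2 * w)) / 2) = v * ((1 + w) / (1 - w))"
      using w w1 by (simp add: divide_simps) (simp add: algebra_simps)?
    also have "\<dots> = v / sinh v * cosh v" unfolding cosh_w[symmetric] by simp
    finally have "(R has_field_derivative v / sinh v * cosh v) (at v)" .
    from DERIV_diff[OF L this] have "((\<lambda>u. arsinh_integral (sinh u) - R u) has_field_derivative 0) (at v)"
      by simp
    thus ?thesis by (rule has_field_derivative_at_within)
  qed
  moreover have "convex S" unfolding S_def by (intro convex_Int convex_ball convex_halfspace_Re_gt)
  ultimately obtain c where c: "\<And>v. v \<in> S \<Longrightarrow> arsinh_integral (sinh v) - R v = c"
    using has_field_derivative_zero_constant[of S "\<lambda>u. arsinh_integral (sinh u) - R u"] by blast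
  have e: "exp (- 2 * complex_of_real x) = of_real (exp (- 2 * x))"
          "1 - complex_of_real (exp (- 2 * x)) = of_real (1 - exp (- 2 * x))" for x
    by (simp_all flip: exp_of_real)
  have ev: "\<forall>\<^sub>F x in at_right (0 :: real). x \<in> {0<..<ln 2}"
    by (intro eventually_at_right_real) auto
  let ?g = "\<lambda>x. arsinh_integral (sinh (of_real x)) - (of_real (x ^ 2 / 2 + x * ln (1 - exp (- 2 * x)))
           + (of_real (pi ^ 2 / 6) - dilog (of_real (exp (- 2 * x)))) / 2)"
  have "(?g \<longlongrightarrow> arsinh_integral (sinh 0) - (of_real 0 + (of_real (pi ^ 2 / 6) - dilog 1) / 2)) (at_right 0)"
  proof (intro tendsto_diff tendsto_add tendsto_dilog tendsto_of_real tendsto_divide tendsto_const)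
    show "((\<lambda>x :: real. arsinh_integral (sinh (of_real x))) \<longlongrightarrow> arsinh_integral (sinh 0)) (at_right 0)"
      by (rule isCont_tendsto_compose[OF isCont_arsinh_integral]) (auto intro!: tendsto_eq_intros)
    show "((\<lambda>x :: real. x ^ 2 / 2 + x * ln (1 - exp (- 2 * x))) \<longlongrightarrow> 0) (at_right 0)"
      by real_asymp
    show "((\<lambda>x :: real. complex_of_real (exp (- 2 * x))) \<longlongrightarrow> 1) (at_right 0)"
      by (auto intro!: tendsto_eq_intros)
    show "\<forall>\<^sub>F x in at_right (0 :: real). norm (complex_of_real (exp (- 2 * x))) \<le> 1"
      using ev by eventually_elim auto
  qed auto
  moreover have "\<forall>\<^sub>F x in at_right (0 :: real). ?g x = c"
    using ev
  proof eventually_elim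
    case (elim x)
    hence "complex_of_real x \<in> S" by (auto simp: S_def)
    from c[OF this] have "arsinh_integral (sinh (of_real x)) - R (of_real x) = c" .
    moreover have "R (of_real x) = of_real (x ^ 2 / 2 + x * ln (1 - exp (- 2 * x)))
           + (of_real (pi ^ 2 / 6) - dilog (of_real (exp (- 2 * x)))) / 2"
      unfolding R_def e using elim by (subst Ln_of_real) auto
    ultimately show ?case by simp
  qed
  ultimately have "((\<lambda>x :: real. c) \<longlongrightarrow> arsinh_integral (sinh 0) -
      (of_real 0 + (of_real (pi ^ 2 / 6) - dilog 1) / 2)) (at_right 0)"
    by (rule Lim_transform_eventually)
  hence "c = 0" by (simp add: tendsto_const_iff dilog_1)
  with c[of u] assms show ?thesis by (simp add: S_def R_def)
qed

text \<open>
  The same identity on the imaginary axis, by approaching \<open>u\<close> horizontally from the right.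
  The condition \<open>exp (- 2 * u) \<noteq> 1\<close> keeps the logarithm away from its branch cut in the limit.
\<close>

lemma arsinh_integral_sinh:
  assumes "norm u < ln 2" "Re u \<ge> 0" "exp (- 2 * u) \<noteq> 1"
  shows "arsinh_integral (sinh u) =
           u ^ 2 / 2 + u * Ln (1 - exp (- 2 * u)) + (of_real (pi ^ 2 / 6) - dilog (exp (- 2 * u))) / 2"
proof (rule tendsto_unique)
  let ?R = "\<lambda>u. u ^ 2 / 2 + u * Ln (1 - exp (- 2 * u)) +
                       (of_real (pi ^ 2 / 6) - dilog (exp (- 2 * u))) / 2"
  let ?u = "\<lambda>x :: real. u + of_real x"
  have u: "(?u \<longlongrightarrow> u) (at_right 0)" by (auto intro!: tendsto_eq_intros)
  have ev: "\<forall>\<^sub>F x in at_right (0 :: real). x > 0"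
    by (rule eventually_at_right_less)
  have ev': "\<forall>\<^sub>F x in at_right (0 :: real). norm (?u x) < ln 2"
    using tendsto_norm[OF u] assms(1) by (rule order_tendstoD(2))
  have "Re (1 - exp (- 2 * u)) > 0" using assms by (intro Re_pos_of_norm_le_1) auto
  hence ln: "1 - exp (- 2 * u) \<notin> \<real>\<^sub>\<le>\<^sub>0" by (auto simp: complex_nonpos_Reals_iff)
  show "((\<lambda>x. arsinh_integral (sinh (?u x))) \<longlongrightarrow> arsinh_integral (sinh u)) (at_right 0)"
    using norm_sinh_less_1[OF assms(1)]
    by (intro isCont_tendsto_compose[OF isCont_arsinh_integral] tendsto_sinh u)
  have "((\<lambda>x. ?R (?u x)) \<longlongrightarrow> ?R u) (at_right 0)"
  proof (intro tendsto_add tendsto_diff tendsto_dilog tendsto_const tendsto_divide tendsto_mult tendsto_power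
           tendsto_exp tendsto_Ln u ln)
    show "\<forall>\<^sub>F x in at_right 0. norm (exp (- 2 * ?u x)) \<le> 1"
      using ev assms(2) by (auto elim!: eventually_mono)
  qed (use assms in auto)
  moreover have "\<forall>\<^sub>F x in at_right 0. ?R (?u x) = arsinh_integral (sinh (?u x))"
    using ev ev' by eventually_elim (rule arsinh_integral_sinh_interior[symmetric], use assms in auto)
  ultimately show "((\<lambda>x. arsinh_integral (sinh (?u x))) \<longlongrightarrow> ?R u) (at_right 0)"
    by (rule Lim_transform_eventually)
qed auto

section \<open>The two central binomial sums\<close>

text \<open>
  Up to a constant factor, the two hypergeometric series are the even and the odd part of one series.
\<close>

lemma sums_even_odd_split:
  fixes f :: "nat \<Rightarrow> 'a :: real_normed_field"
  assumes "f sums a" "(\<lambda>n. (-1) ^ n * f n) sums b"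
  shows "(\<lambda>n. f (2 * n)) sums ((a + b) / 2)"
    and "(\<lambda>n. f (2 * n + 1)) sums ((a - b) / 2)"
proof -
  have I: "{n * 2..<n * 2 + 2} = {2 * n, 2 * n + 1}" for n :: nat by auto
  have "(\<lambda>n. (f n + (-1) ^ n * f n) / 2) sums ((a + b) / 2)"
    by (intro sums_divide sums_add assms)
  from sums_group[OF this, of 2] show "(\<lambda>n. f (2 * n)) sums ((a + b) / 2)"
    by (simp add: I mult.commute)
  have "(\<lambda>n. (f n - (-1) ^ n * f n) / 2) sums ((a - b) / 2)"
    by (intro sums_divide sums_diff assms)
  from sums_group[OF this, of 2] show "(\<lambda>n. f (2 * n + 1)) sums ((a - b) / 2)"
    by (simp add: I mult.commute)
qed

text \<open>
  Since \<open>pochhammer (1/2) m / fact m\<close> is the central binomial coefficient \<open>(2 * m) choose m\<close> divided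
  by \<open>4 ^ m\<close>, this is \<open>((2 * m) choose m) / (16 ^ m * (2 * m + 1)\<^sup>2)\<close>.  The form with Pochhammer
  symbols fits both the binomial series and the hypergeometric coefficients.
\<close>

definition central_term :: "nat \<Rightarrow> real" where
  "central_term m = pochhammer (1 / 2) m / fact m / (real (2 * m + 1) ^ 2 * 4 ^ m)"

lemma central_term_nonneg: "central_term m \<ge> 0"
  unfolding central_term_def using pochhammer_half_nonneg by (intro divide_nonneg_nonneg) auto

lemma summable_central_term: "summable central_term"
proof (rule summable_comparison_test'[of "\<lambda>m. (1 / 4) ^ m"])
  show "summable (\<lambda>m. (1 / 4 :: real) ^ m)" by (intro summable_geometric) auto
  show "norm (central_term m) \<le> (1 / 4) ^ m" for m
  proof -
    have "central_term m \<le> 1 / (1 * 4 ^ m)"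
      unfolding central_term_def using pochhammer_half_nonneg[of m] pochhammer_half_le_fact[of m]
      by (intro frac_le mult_mono) auto
    thus ?thesis using central_term_nonneg[of m] by (simp add: power_one_over)
  qed
qed

lemma summable_alternating_central_term: "summable (\<lambda>m. (-1) ^ m * central_term m)"
  by (rule summable_comparison_test'[OF summable_central_term, of 0])
     (simp add: abs_mult power_abs central_term_nonneg)

lemma arsinh_integral_half:
  "arsinh_integral (1 / 2) = of_real ((\<Sum>m. (-1) ^ m * central_term m) / 2)"
proof -
  have "(\<lambda>m. complex_of_real ((-1) ^ m * central_term m / 2)) sums
          of_real ((\<Sum>m. (-1) ^ m * central_term m) / 2)"
    by (intro sums_of_real sums_divide summable_sums summable_alternating_central_term)
  also have "(\<lambda>m. complex_of_real ((-1) ^ m * central_term m / 2)) =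
             (\<lambda>m. ((- 1 / 2) gchoose m) / of_nat (2 * m + 1) ^ 2 * (1 / 2) ^ (2 * m + 1))"
  proof
    fix m
    have "(1 / 2 :: complex) ^ (2 * m + 1) = 1 / 2 / 4 ^ m"
      by (simp add: power_mult power2_eq_square power_divide)
    thus "complex_of_real ((-1) ^ m * central_term m / 2) =
            ((- 1 / 2) gchoose m) / of_nat (2 * m + 1) ^ 2 * (1 / 2) ^ (2 * m + 1)"
      unfolding gbinomial_minus_half by (simp add: central_term_def)
  qed
  finally show ?thesis by (simp add: arsinh_integral_def sums_iff)
qed

lemma arsinh_integral_half_i:
  "arsinh_integral (- \<i> / 2) = - \<i> * of_real ((\<Sum>m. central_term m) / 2)"
proof -
  have "(\<lambda>m. - \<i> * complex_of_real (central_term m / 2)) sums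
          (- \<i> * of_real ((\<Sum>m. central_term m) / 2))"
    using summable_central_term by (intro sums_mult sums_of_real sums_divide summable_sums)
  also have "(\<lambda>m. - \<i> * complex_of_real (central_term m / 2)) =
             (\<lambda>m. ((- 1 / 2) gchoose m) / of_nat (2 * m + 1) ^ 2 * (- \<i> / 2) ^ (2 * m + 1))"
  proof
    fix m
    have "(- \<i> / 2) ^ (2 * m + 1) = ((- \<i> / 2) ^ 2) ^ m * (- \<i> / 2)"
      by (simp only: power_add power_mult power_one_right)
    also have "(- \<i> / 2) ^ 2 = (- 1) / 4" by (simp add: power2_eq_square)
    also have "((- 1) / 4) ^ m * (- \<i> / 2) = - \<i> / 2 * ((-1) ^ m / 4 ^ m)"
      by (simp only: power_divide mult.commute)
    finally have "(- \<i> / 2) ^ (2 * m + 1) = - \<i> / 2 * ((-1) ^ m / 4 ^ m)" .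
    hence "((- 1 / 2) gchoose m) / of_nat (2 * m + 1) ^ 2 * (- \<i> / 2) ^ (2 * m + 1) =
             ((-1) ^ m * (-1) ^ m) * (- \<i> * complex_of_real (central_term m / 2))"
      unfolding gbinomial_minus_half by (simp add: central_term_def mult_ac)
    also have "(-1) ^ m * (-1) ^ m = (1 :: complex)"
      by (simp flip: power_mult_distrib)
    finally show "- \<i> * complex_of_real (central_term m / 2) =
            ((- 1 / 2) gchoose m) / of_nat (2 * m + 1) ^ 2 * (- \<i> / 2) ^ (2 * m + 1)"
      by simp
  qed
  finally show ?thesis by (simp add: arsinh_integral_def sums_iff)
qed

text \<open>
  For the reciprocal \<open>\<alpha>\<close> of the golden ratio, \<open>\<alpha>\<^sup>2 = 1 - \<alpha>\<close>, so reflection at \<open>\<alpha>\<close>, Landen's identity at \<open>\<alpha>\<^sup>2\<close> (where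
  \<open>\<alpha>\<^sup>2 / (\<alpha>\<^sup>2 - 1) = - \<alpha>\<close>) and duplication at \<open>\<alpha>\<close> are three linear equations in the
  dilogarithms of \<open>\<alpha>\<close>, \<open>- \<alpha>\<close> and \<open>\<alpha>\<^sup>2\<close>.
\<close>

lemma dilog_golden:
  fixes \<alpha> :: real
  defines "\<alpha> \<equiv> (sqrt 5 - 1) / 2"
  shows "dilog (of_real (\<alpha> ^ 2)) = of_real (pi ^ 2 / 15 - ln \<alpha> ^ 2)"
    and "1 / 2 < \<alpha>" "\<alpha> < 1" "1 - \<alpha> ^ 2 = \<alpha>"
proof -
  have "2 < sqrt 5" "sqrt 5 < 3" by (auto intro: real_less_rsqrt real_less_lsqrt)
  thus \<alpha>: "1 / 2 < \<alpha>" "\<alpha> < 1" by (simp_all add: \<alpha>_def)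
  show sq: "1 - \<alpha> ^ 2 = \<alpha>" by (simp add: \<alpha>_def power2_eq_square field_simps)
  define l where "l = complex_of_real (ln \<alpha>)"
  define X where "X = dilog (of_real (\<alpha> ^ 2))"
  have sq': "1 - complex_of_real \<alpha> = of_real (\<alpha> ^ 2)" "1 - complex_of_real (\<alpha> ^ 2) = of_real \<alpha>"
    using sq by (metis of_real_1 of_real_diff diff_diff_eq2 add_diff_cancel_left')+
  have Ln: "Ln (of_real \<alpha>) = l" "Ln (of_real (\<alpha> ^ 2)) = 2 * l"
    using \<alpha> by (auto simp: l_def Ln_of_real ln_realpow simp del: of_real_power)
  have "\<bar>\<alpha> ^ 2\<bar> < 1 / 2" using \<alpha> sq by (simp add: abs_if)
  hence n: "norm (complex_of_real (\<alpha> ^ 2)) < 1 / 2" unfolding norm_of_real .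
  have "dilog (of_real \<alpha>) + X = of_real (pi ^ 2 / 6) - 2 * l ^ 2"
    using dilog_reflection[of "of_real \<alpha>"] \<alpha> n
    unfolding sq' Ln X_def by (simp add: power2_eq_square)
  moreover have "X + dilog (- of_real \<alpha>) = - (l ^ 2) / 2"
  proof -
    have "complex_of_real (\<alpha> ^ 2) / (of_real (\<alpha> ^ 2) - 1) = of_real (\<alpha> ^ 2 / (\<alpha> ^ 2 - 1))" by simp
    also have "\<alpha> ^ 2 / (\<alpha> ^ 2 - 1) = - \<alpha>"
    proof -
      have "\<alpha> ^ 2 - 1 = - \<alpha>" using sq by linarith
      thus ?thesis using \<alpha> by (simp add: power2_eq_square)
    qed
    finally show ?thesis
      using dilog_Landen[OF n] unfolding sq' Ln X_def by simp
  qed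
  moreover have "dilog (of_real \<alpha>) + dilog (- of_real \<alpha>) = X / 2"
    using dilog_duplication[of "of_real \<alpha>"] \<alpha> by (simp add: X_def)
  ultimately have "5 / 2 * X = of_real (pi ^ 2 / 6) - 5 / 2 * l ^ 2" by algebra
  hence "X = of_real (pi ^ 2 / 15) - l ^ 2" by (simp add: field_simps)
  thus "dilog (of_real (\<alpha> ^ 2)) = of_real (pi ^ 2 / 15 - ln \<alpha> ^ 2)"
    by (simp add: X_def l_def)
qed

text \<open>
  The golden ratio appears because \<open>u = - ln \<alpha>\<close> solves \<open>sinh u = 1 / 2\<close>; then
  \<open>exp (- 2 * u) = \<alpha>\<^sup>2\<close>, and all terms with \<open>ln \<alpha>\<close> cancel.
\<close>

lemma alternating_central_sum: "(\<Sum>m. (-1) ^ m * central_term m) = pi ^ 2 / 10"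
proof -
  define \<alpha> where "\<alpha> = (sqrt 5 - 1) / 2"
  note \<alpha> = dilog_golden[folded \<alpha>_def]
  have pos: "\<alpha> > 0" using \<alpha>(2) by simp
  define u where "u = complex_of_real (- ln \<alpha>)"
  have exp_u: "exp (- 2 * u) = of_real (\<alpha> ^ 2)"
  proof -
    have "exp (2 * ln \<alpha>) = \<alpha> ^ 2" using pos by (simp add: exp_double)
    moreover have "- 2 * u = of_real (2 * ln \<alpha>)" by (simp add: u_def)
    ultimately show ?thesis by (metis exp_of_real)
  qed
  have sinh_u: "sinh u = 1 / 2"
  proof -
    have "\<alpha> * (\<alpha> + 1) = 1" using \<alpha>(4) by (simp add: power2_eq_square algebra_simps)
    hence "inverse \<alpha> = \<alpha> + 1" using pos by (simp add: field_simps)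
    hence "exp (- ln \<alpha>) - exp (ln \<alpha>) = 1" using pos by (simp add: exp_minus)
    moreover have "sinh u = of_real (exp (- ln \<alpha>) - exp (ln \<alpha>)) / 2"
      by (simp add: u_def sinh_field_def exp_of_real[symmetric])
    ultimately show ?thesis by simp
  qed
  have one: "1 - complex_of_real (\<alpha> ^ 2) = of_real \<alpha>"
    using \<alpha>(4) by (metis of_real_1 of_real_diff)
  have arsinh: "arsinh_integral (sinh u) =
          u ^ 2 / 2 + u * Ln (1 - exp (- 2 * u)) + (of_real (pi ^ 2 / 6) - dilog (exp (- 2 * u))) / 2"
  proof (rule arsinh_integral_sinh)
    have "ln (1 / 2) < ln \<alpha>" using \<alpha>(2) by (subst ln_less_cancel_iff) auto
    hence "- ln \<alpha> < ln 2" by (simp add: ln_div)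
    moreover have "ln \<alpha> < 0" using pos \<alpha>(3) by simp
    ultimately show "norm u < ln 2" "Re u \<ge> 0" by (auto simp: u_def)
    show "exp (- 2 * u) \<noteq> 1" unfolding exp_u using \<alpha>(4) pos by (metis diff_self of_real_eq_1_iff less_irrefl)
  qed
  have cancel: "x / 2 - x + (p / 6 - (p / 15 - x)) / 2 = p / 20" for x p :: real
    by (simp add: add_divide_distrib)
  from arsinh have "arsinh_integral (1 / 2) = of_real (ln \<alpha> ^ 2 / 2 - ln \<alpha> * ln \<alpha> +
           (pi ^ 2 / 6 - (pi ^ 2 / 15 - ln \<alpha> ^ 2)) / 2)"
    unfolding sinh_u exp_u one \<alpha>(1) using pos by (simp add: Ln_of_real u_def)
  also have "ln \<alpha> ^ 2 / 2 - ln \<alpha> * ln \<alpha> + (pi ^ 2 / 6 - (pi ^ 2 / 15 - ln \<alpha> ^ 2)) / 2 = pi ^ 2 / 20"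
    using cancel[of "ln \<alpha> ^ 2" "pi ^ 2"] by (simp only: power2_eq_square)
  finally show ?thesis unfolding arsinh_integral_half of_real_eq_iff by simp
qed

text \<open>
  At \<open>u = - \<i> * pi / 6\<close> the point \<open>exp (- 2 * u)\<close> is the sixth root of unity \<open>cis (pi / 3)\<close>.  As
  \<open>1 - cis (pi / 3) = cis (- (pi / 3))\<close>, the elementary terms of the identity are real, so only the
  dilogarithm contributes to the imaginary part.
\<close>

lemma central_sum_eq_Im_dilog: "(\<Sum>m. central_term m) = Im (dilog (cis (pi / 3)))"
proof -
  define u where "u = - \<i> * of_real (pi / 6)"
  have exp_u: "exp (- 2 * u) = cis (pi / 3)"
    by (simp add: u_def cis_conv_exp)
  have one: "1 - cis (pi / 3) = cis (- (pi / 3))"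
    by (simp add: complex_eq_iff cos_60 sin_60)
  have "arsinh_integral (sinh u) =
          u ^ 2 / 2 + u * Ln (1 - exp (- 2 * u)) + (of_real (pi ^ 2 / 6) - dilog (exp (- 2 * u))) / 2"
  proof (rule arsinh_integral_sinh)
    show "norm u < ln 2" using pi_less_4 ln2_ge_two_thirds by (simp add: u_def norm_mult)
    show "exp (- 2 * u) \<noteq> 1" unfolding exp_u by (simp add: complex_eq_iff cos_60)
  qed (simp add: u_def)
  moreover have "Ln (cis (- (pi / 3))) = - \<i> * of_real (pi / 3)"
    by (subst cis_conv_exp, subst Ln_exp) (use pi_gt_zero in \<open>auto simp del: pi_gt_zero\<close>)
  moreover have "sinh u = - \<i> / 2"
  proof -
    have "\<i> * u = of_real (pi / 6)" by (simp add: u_def)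
    thus ?thesis unfolding sinh_conv_sin by (simp only: sin_of_real sin_30) simp
  qed
  ultimately have "- \<i> * of_real ((\<Sum>m. central_term m) / 2) =
      u ^ 2 / 2 + u * (- \<i> * of_real (pi / 3)) + (of_real (pi ^ 2 / 6) - dilog (cis (pi / 3))) / 2"
    unfolding exp_u one by (simp only: arsinh_integral_half_i)
  from arg_cong[OF this, of Im] show ?thesis
    by (simp add: u_def power2_eq_square)
qed

text \<open>
  Duplication passes from the sixth root of unity to the cube root \<open>\<omega> = cis (2 * pi / 3)\<close>, because
  \<open>- cis (pi / 3) = cnj \<omega>\<close>.  The imaginary part of \<open>dilog \<omega>\<close> compares the inverse squares of the
  numbers congruent to \<open>1\<close> and to \<open>2\<close> modulo \<open>3\<close>.  The former add up to \<open>\<psi>' (1/3) / 9\<close>; the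
  latter then follow from the sum of all inverse squares, as the multiples of \<open>3\<close> make up one
  ninth of it.
\<close>

lemma Im_dilog_cis_pi_third:
  "Im (dilog (cis (pi / 3))) = 1 / (2 * sqrt 3) * deriv Digamma (1 / 3 :: real) - pi ^ 2 / (3 * sqrt 3)"
proof -
  define \<omega> where "\<omega> = cis (2 * pi / 3)"
  have w3: "\<omega> ^ 3 = 1" by (simp add: \<omega>_def Complex.DeMoivre)
  have w: "\<omega> = Complex (- 1 / 2) (sqrt 3 / 2)"
    by (simp add: \<omega>_def complex_eq_iff cos_120 sin_120)
  have wsqr: "\<omega> ^ 2 = cnj \<omega>" unfolding w by (simp add: complex_eq_iff power2_eq_square)
  from w have Imw: "Im \<omega> = sqrt 3 / 2" by simp

  define T where "T = deriv Digamma (1 / 3 :: real) / 9"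
  have T: "(\<lambda>k. 1 / real (3 * k + 1) ^ 2) sums T"
  proof -
    have "deriv Digamma (1 / 3 :: real) = Polygamma 1 (1 / 3)"
      by (intro DERIV_imp_deriv) (auto intro!: derivative_eq_intros)
    hence "(\<lambda>k. inverse ((1 / 3 + real k) ^ 2)) sums deriv Digamma (1 / 3)"
      using Polygamma_LIMSEQ[of "1 / 3 :: real" 1] by (simp add: numeral_2_eq_2)
    hence "(\<lambda>k. inverse ((1 / 3 + real k) ^ 2) / 9) sums T"
      unfolding T_def by (rule sums_divide)
    also have "(\<lambda>k. inverse ((1 / 3 + real k) ^ 2) / 9) = (\<lambda>k. 1 / real (3 * k + 1) ^ 2)"
      by (auto simp: fun_eq_iff divide_simps power2_eq_square) (auto simp: algebra_simps)?
    finally show ?thesis .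
  qed
  have I: "{n * 3..<n * 3 + 3} = {3 * n, 3 * n + 1, 3 * n + 2}" for n :: nat by auto
  have T': "(\<lambda>k. 1 / real (3 * k + 2) ^ 2) sums (4 * pi ^ 2 / 27 - T)"
  proof -
    have "(\<lambda>k. 1 / real (3 * k) ^ 2 + 1 / real (3 * k + 1) ^ 2 + 1 / real (3 * k + 2) ^ 2) sums (pi ^ 2 / 6)"
      using sums_group[OF basel_sums, of 3] unfolding I by (simp add: add_ac)
    moreover have "(\<lambda>k. 1 / real (3 * k) ^ 2) sums (pi ^ 2 / 6 / 9)"
      using sums_divide[OF basel_sums, of 9] by (simp add: power2_eq_square mult_ac)
    ultimately have "(\<lambda>k. 1 / real (3 * k) ^ 2 + 1 / real (3 * k + 1) ^ 2 + 1 / real (3 * k + 2) ^ 2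
        - 1 / real (3 * k) ^ 2 - 1 / real (3 * k + 1) ^ 2) sums (pi ^ 2 / 6 - pi ^ 2 / 6 / 9 - T)"
      by (intro sums_diff T)
    thus ?thesis by simp
  qed

  have "(\<lambda>n. \<omega> ^ n / of_nat n ^ 2) sums dilog \<omega>" by (rule dilog_sums) (simp add: \<omega>_def)
  hence "(\<lambda>n. Im (\<omega> ^ n / of_nat n ^ 2)) sums Im (dilog \<omega>)"
    by (rule bounded_linear.sums[OF bounded_linear_Im])
  also have "(\<lambda>n. Im (\<omega> ^ n / of_nat n ^ 2)) = (\<lambda>n. Im (\<omega> ^ n) / real n ^ 2)"
    by (intro ext) (metis Im_divide_of_real of_real_of_nat_eq of_real_power)
  finally have "(\<lambda>n. Im (\<omega> ^ n) / real n ^ 2) sums Im (dilog \<omega>)" .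
  from sums_group[OF this, of 3]
  have "(\<lambda>k. Im (\<omega> ^ (3 * k)) / real (3 * k) ^ 2 + Im (\<omega> ^ (3 * k + 1)) / real (3 * k + 1) ^ 2 +
          Im (\<omega> ^ (3 * k + 2)) / real (3 * k + 2) ^ 2) sums Im (dilog \<omega>)"
    unfolding I by (simp add: add_ac)
  moreover have "\<omega> ^ (3 * k) = 1" "\<omega> ^ (3 * k + 1) = \<omega>" "\<omega> ^ (3 * k + 2) = cnj \<omega>" for k
    by (simp_all only: power_add power_mult w3 wsqr power_one power_one_right mult_1)
  ultimately have "(\<lambda>k. sqrt 3 / 2 * (1 / real (3 * k + 1) ^ 2 - 1 / real (3 * k + 2) ^ 2)) sums Im (dilog \<omega>)"
    by (simp only: Imw complex_cnj one_complex.sel cnj.sel) (simp add: right_diff_distrib)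
  moreover have "(\<lambda>k. sqrt 3 / 2 * (1 / real (3 * k + 1) ^ 2 - 1 / real (3 * k + 2) ^ 2)) sums
                   (sqrt 3 / 2 * (T - (4 * pi ^ 2 / 27 - T)))"
    by (intro sums_mult sums_diff T T')
  ultimately have "Im (dilog \<omega>) = sqrt 3 / 2 * (T - (4 * pi ^ 2 / 27 - T))" by (rule sums_unique2)
  moreover have "Im (dilog (cis (pi / 3))) = 3 / 2 * Im (dilog \<omega>)"
  proof -
    have "cis (pi / 3) ^ 2 = \<omega>" by (simp add: \<omega>_def Complex.DeMoivre)
    moreover have "- cis (pi / 3) = cnj \<omega>"
      by (simp add: \<omega>_def complex_eq_iff cos_60 sin_60 cos_120 sin_120)
    ultimately have "dilog (cis (pi / 3)) + cnj (dilog \<omega>) = dilog \<omega> / 2"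
      using dilog_duplication[of "cis (pi / 3)"] cnj_dilog[of \<omega>] by (simp add: \<omega>_def)
    from arg_cong[OF this, of Im] show ?thesis by simp
  qed
  moreover have "1 / (2 * sqrt 3) * deriv Digamma (1 / 3 :: real) - pi ^ 2 / (3 * sqrt 3) =
                   1 / sqrt 3 * (deriv Digamma (1 / 3) / 2 - pi ^ 2 / 3)"
    by (simp add: right_diff_distrib)
  moreover have "1 / sqrt 3 = sqrt 3 / 3" by (simp add: field_simps)
  ultimately show ?thesis by (simp only: T_def) (simp add: algebra_simps)
qed

section \<open>The hypergeometric series\<close>

text \<open>
  The parameter pairs \<open>a, a + 1\<close> of the hypergeometric series produce the squared linear
  denominators; all other factors combine by the duplication formula for Pochhammer symbols.
\<close>

lemma pochhammer_quotient:
  fixes a :: real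
  assumes "a > 0"
  shows "pochhammer a n / pochhammer (a + 1) n = a / (a + real n)"
proof -
  have "pochhammer (a + 1) n > 0" using assms by (intro pochhammer_pos) auto
  moreover have "a * pochhammer (a + 1) n = (a + real n) * pochhammer a n"
    using pochhammer_rec[of a n] pochhammer_rec'[of a n] by simp
  ultimately show ?thesis using assms by (simp add: field_simps)
qed

lemma hypergeo_term_even:
  "pochhammer (1/4) n * pochhammer (1/4) n * pochhammer (1/4) n * pochhammer (3/4) n /
     (pochhammer (1/2) n * pochhammer (5/4) n * pochhammer (5/4) n) * ((1/16) ^ n / fact n) =
   central_term (2 * n)" (is "?lhs = _")
proof -
  have "?lhs = (pochhammer (1/4) n / pochhammer (5/4) n) ^ 2 *
     (pochhammer (1/4) n * pochhammer (3/4) n / (pochhammer (1/2) n * fact n * 16 ^ n))"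
    by (simp add: power2_eq_square power_one_over mult_ac)
  also have "pochhammer (1/4) n / pochhammer (5/4) n = 1 / real (2 * (2 * n) + 1)"
    using pochhammer_quotient[of "1/4" n] by (simp add: divide_simps mult.commute)
  also have "(1 / real (2 * (2 * n) + 1)) ^ 2 *
     (pochhammer (1/4) n * pochhammer (3/4) n / (pochhammer (1/2) n * fact n * 16 ^ n)) =
     central_term (2 * n)"
    unfolding central_term_def fact_double
    using pochhammer_double[of "1/4 :: real" n] by (simp add: power_mult power_divide)
  finally show ?thesis .
qed

lemma hypergeo_term_odd:
  "pochhammer (3/4) n * pochhammer (3/4) n * pochhammer (3/4) n * pochhammer (5/4) n /
     (pochhammer (3/2) n * pochhammer (7/4) n * pochhammer (7/4) n) * ((1/16) ^ n / fact n) =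
   72 * central_term (2 * n + 1)" (is "?lhs = _")
proof -
  have "?lhs = (pochhammer (3/4) n / pochhammer (7/4) n) ^ 2 *
     (pochhammer (3/4) n * pochhammer (5/4) n / (pochhammer (3/2) n * fact n * 16 ^ n))"
    by (simp add: power2_eq_square power_one_over mult_ac)
  also have "pochhammer (3/4) n / pochhammer (7/4) n = 3 / real (2 * (2 * n + 1) + 1)"
    using pochhammer_quotient[of "3/4" n] by (simp add: divide_simps mult.commute)
  also have "(3 / real (2 * (2 * n + 1) + 1)) ^ 2 *
     (pochhammer (3/4) n * pochhammer (5/4) n / (pochhammer (3/2) n * fact n * 16 ^ n)) =
     72 * central_term (2 * n + 1)"
  proof -
    have "pochhammer (1/2 :: real) (2 * n + 1) = 1/2 * (4 ^ n * pochhammer (3/4) n * pochhammer (5/4) n)"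
      using pochhammer_rec[of "1/2 :: real" "2 * n"] pochhammer_double[of "3/4 :: real" n]
      by (simp add: power_mult)
    moreover have "(fact (2 * n + 1) :: real) = 4 ^ n * fact n * pochhammer (3/2) n"
      using pochhammer_rec[of "1 :: real" "2 * n"] pochhammer_double[of "1 :: real" n]
      by (simp add: power_mult pochhammer_fact)
    ultimately show ?thesis
      unfolding central_term_def by (simp only:) (simp add: power_mult power_divide)
  qed
  finally show ?thesis .
qed

theorem theorem1:
  shows "hypergeo_4F3 (1/4) (1/4) (1/4) (3/4) (1/2) (5/4) (5/4) (1/16 :: real) =
           1/2 * (pi^2 * (1/10 - 1 / (3 * sqrt 3)) +
                  1 / (2 * sqrt 3) * deriv Digamma (1/3 :: real)) \<and>
         hypergeo_4F3 (3/4) (3/4) (3/4) (5/4) (3/2) (7/4) (7/4) (1/16 :: real) =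
           36 * (1 / (2 * sqrt 3) * deriv Digamma (1/3 :: real) -
                 pi^2 * (1/10 + 1 / (3 * sqrt 3)))"
proof -
  define P where "P = 1 / (2 * sqrt 3) * deriv Digamma (1 / 3 :: real) - pi ^ 2 / (3 * sqrt 3)"
  have pos: "central_term sums P"
    using summable_sums[OF summable_central_term] central_sum_eq_Im_dilog Im_dilog_cis_pi_third
    by (simp add: P_def)
  have alt: "(\<lambda>m. (-1) ^ m * central_term m) sums (pi ^ 2 / 10)"
    using alternating_central_sum summable_alternating_central_term by (simp add: sums_iff)
  note split = sums_even_odd_split[OF pos alt]
  have "hypergeo_4F3 (1/4) (1/4) (1/4) (3/4) (1/2) (5/4) (5/4) (1/16 :: real) = (P + pi ^ 2 / 10) / 2"
    unfolding hypergeo_4F3_def hypergeo_term_even using split(1) by (simp add: sums_iff)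
  moreover have "hypergeo_4F3 (3/4) (3/4) (3/4) (5/4) (3/2) (7/4) (7/4) (1/16 :: real) =
                   72 * ((P - pi ^ 2 / 10) / 2)"
    unfolding hypergeo_4F3_def hypergeo_term_odd using sums_mult[OF split(2), of 72] by (simp add: sums_iff)
  ultimately show ?thesis
    by (simp add: P_def algebra_simps add_divide_distrib diff_divide_distrib)
qed

end
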